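(* For any $n\ge2$, $\mathbf{m}$ with $m_i\ge 2$, and any $t\in\mathbb{N}$, $$\Pr\left[t<H<\infty\right]\le\exp\left\{-\frac{\left(\left\lfloor\frac{t}{n}-1\right\rfloor\right)^2}{2q_{n,\mathbf{m}}}\right\},$$ where $H=\inf\{\tau\ge 1:\mathbf{A}^\tau \text{ is a PNE of } G_{n,\mathbf{m}}\}$ is the hitting time of the set of PNE by the clockwork best-response dynamic.
   Context: A random game $G_{n,\mathbf{m}}$ has $n\ge 2$ players; player $i$ has action set $[m_i]=\{1,\dots,m_i\}$, $m_i\ge2$; $\mathcal{M}=\times_i[m_i]$. Payoffs $U_i(\mathbf{a})$ are drawn from a fixed atomless distribution on $\mathbb{R}$, independently across $i$ and $\mathbf{a}\in\mathcal{M}$. The best response $B_i(\mathbf{a}_{-i})=\arg\max_{x\in[m_i]}U_i(x,\mathbf{a}_{-i})$ is a.s. unique; a PNE is a profile $\mathbf{a}$ with $a_i=B_i(\mathbf{a}_{-i})$ for all $i$. The clockwork sequence is $s_{\texttt{c}}(t)=1+((t-1)\bmod n)$. The clockwork best-response dynamic: $\mathbf{A}^0$ uniform on $\mathcal{M}$ independent of payoffs; for $t\ge1$ with $i=s_{\texttt{c}}(t)$, $A^t_j=A^{t-1}_j$ ($j\ne i$) and $A^t_i=B_i(\mathbf{A}^{t-1}_{-i})$. $q_{n,\mathbf{m}}=\prod_i m_i/\max_i m_i$. $\inf\emptyset=\infty$. *)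

theory Defs
  imports "HOL-Probability.Probability"
begin

(* Players are 0,...,n-1 (player i here = player i+1 of the paper);
   player i has actions 0,...,m i - 1 (action x here = action x+1 of the paper).
   Profiles are extensional functions on {0..<n}. *)
definition profiles :: "nat \<Rightarrow> (nat \<Rightarrow> nat) \<Rightarrow> (nat \<Rightarrow> nat) set" where
  "profiles n m = PiE {0..<n} (\<lambda>i. {0..<m i})"

(* payoff U (i, a) of player i at profile a *)
type_synonym payoff = "nat \<times> (nat \<Rightarrow> nat) \<Rightarrow> real"

(* best response of player i against a_{-i} (the i-th entry of a is ignored);
   a.s. unique; ties (probability zero) broken towards the least action *)
definition best_resp :: "(nat \<Rightarrow> nat) \<Rightarrow> payoff \<Rightarrow> nat \<Rightarrow> (nat \<Rightarrow> nat) \<Rightarrow> nat" where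
  "best_resp m U i a =
     (LEAST x. x < m i \<and> (\<forall>y < m i. U (i, a(i := y)) \<le> U (i, a(i := x))))"

definition is_PNE :: "nat \<Rightarrow> (nat \<Rightarrow> nat) \<Rightarrow> payoff \<Rightarrow> (nat \<Rightarrow> nat) \<Rightarrow> bool" where
  "is_PNE n m U a \<longleftrightarrow> (\<forall>i<n. a i = best_resp m U i a)"

(* clockwork best-response dynamic: at step t+1 (t \<ge> 0) the player t mod n
   (= player 1 + ((t+1)-1) mod n in the paper's 1-based indexing) best-responds *)
primrec clockwork :: "nat \<Rightarrow> (nat \<Rightarrow> nat) \<Rightarrow> payoff \<Rightarrow> (nat \<Rightarrow> nat) \<Rightarrow> nat \<Rightarrow> (nat \<Rightarrow> nat)" where
  "clockwork n m U a0 0 = a0"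
| "clockwork n m U a0 (Suc t) =
     (clockwork n m U a0 t)(t mod n := best_resp m U (t mod n) (clockwork n m U a0 t))"

definition hit_time :: "nat \<Rightarrow> (nat \<Rightarrow> nat) \<Rightarrow> payoff \<Rightarrow> (nat \<Rightarrow> nat) \<Rightarrow> enat" where
  "hit_time n m U a0 = Inf (enat ` {\<tau>. 1 \<le> \<tau> \<and> is_PNE n m U (clockwork n m U a0 \<tau>)})"

definition q_nm :: "nat \<Rightarrow> (nat \<Rightarrow> nat) \<Rightarrow> real" where
  "q_nm n m = real (\<Prod>i<n. m i) / real (Max (m ` {0..<n}))"

definition game_space :: "nat \<Rightarrow> (nat \<Rightarrow> nat) \<Rightarrow> real measure \<Rightarrow> (payoff \<times> (nat \<Rightarrow> nat)) measure" where
  "game_space n m D =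
     (PiM ({0..<n} \<times> profiles n m) (\<lambda>_. D)) \<Otimes>\<^sub>M measure_pmf (pmf_of_set (profiles n m))"

end

theory Submission
  imports Defs
begin

text \<open>
  The dynamic depends on the payoffs only through the table of best responses. Swapping the payoffs
  of two actions in each context shows that this table is uniformly distributed, so all
  probabilities become counts of pairs of a table and an initial profile.

  Let player \<open>k\<close> have the most actions, so that \<open>q\<close> is the number of contexts of \<open>k\<close>. If the
  dynamic ever queries the same table entry twice before reaching an equilibrium, it is periodic
  and never reaches one. Hence on \<open>t < H < \<infinity>\<close> all entries queried up to time \<open>t\<close> are distinct,
  so the answers are fresh uniform actions, and the contexts seen by \<open>k\<close> in the first
  \<open>R = \<lfloor>t / n\<rfloor>\<close> rounds are distinct although they behave like independent uniform samples from
  \<open>q\<close> values. The birthday bound gives \<open>exp (- R (R - 1) / (2 q))\<close>.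

  For \<open>t < n\<close> the floor in the claim is \<open>-1\<close> and its square is \<open>1\<close>, so the bound is not trivial.
  Here one uses that the first step reaches an equilibrium with probability \<open>m\<^sub>0 / (q m\<^sub>k)\<close>,
  and that the game has no equilibrium with probability at least
  \<open>(1 - 1/q) (1 - 1/m\<^sub>k) / q\<close>; these add up to at least \<open>1 / (2 q)\<close>.
\<close>

section \<open>Best responses\<close>

lemma best_resp_update [simp]: "best_resp m U i (a(i := x)) = best_resp m U i a"
  by (simp add: best_resp_def)

lemma best_resp_maximal:
  assumes "0 < m i"
  shows "best_resp m U i a < m i \<and> (\<forall>y<m i. U (i, a(i := y)) \<le> U (i, a(i := best_resp m U i a)))"
proof -
  let ?S = "(\<lambda>y. U (i, a(i := y))) ` {..<m i}"
  have "Max ?S \<in> ?S"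
    using assms by (intro Max_in) auto
  then obtain x where "x < m i" "U (i, a(i := x)) = Max ?S"
    by auto
  then have "x < m i \<and> (\<forall>y<m i. U (i, a(i := y)) \<le> U (i, a(i := x)))"
    by auto
  then show ?thesis
    unfolding best_resp_def by (rule LeastI)
qed

lemma best_resp_eqI:
  assumes "x < m i" "\<And>y. y < m i \<Longrightarrow> y \<noteq> x \<Longrightarrow> U (i, a(i := y)) < U (i, a(i := x))"
  shows "best_resp m U i a = x"
proof (rule ccontr)
  have "best_resp m U i a < m i" "U (i, a(i := x)) \<le> U (i, a(i := best_resp m U i a))"
    using best_resp_maximal[of m i U a] assms(1) by auto
  moreover assume "best_resp m U i a \<noteq> x"
  ultimately show False
    using assms(2)[of "best_resp m U i a"] by simp
qed

text \<open>Spells out the least maximiser as finitely many payoff comparisons, from which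
  measurability can be read off; the last conjunct encodes the tie-break.\<close>

lemma best_resp_eq_iff:
  assumes "0 < m i"
  shows "best_resp m U i a = x \<longleftrightarrow>
    x < m i \<and> (\<forall>y<m i. U (i, a(i := y)) \<le> U (i, a(i := x))) \<and>
    (\<forall>z<x. \<exists>y<m i. U (i, a(i := z)) < U (i, a(i := y)))" (is "_ \<longleftrightarrow> ?R")
proof
  assume eq: "best_resp m U i a = x"
  have "\<exists>y<m i. U (i, a(i := z)) < U (i, a(i := y))" if "z < x" for z
    using not_less_Least[of z "\<lambda>x. x < m i \<and> (\<forall>y<m i. U (i, a(i := y)) \<le> U (i, a(i := x)))"]
      that eq best_resp_maximal[of m i U a, OF assms] unfolding best_resp_def[symmetric]
    by (meson less_trans not_le)
  then show ?R
    using best_resp_maximal[of m i U a, OF assms] eq by auto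
next
  assume ?R
  then show "best_resp m U i a = x"
    unfolding best_resp_def by (intro Least_equality) (auto simp: not_le[symmetric])
qed

text \<open>Prescribing values on \<open>J\<close> replaces those factors of the product by
  singletons. The multiplicative form avoids division in the natural numbers.\<close>

lemma card_PiE_fixed:
  assumes "finite C" "\<And>c. c \<in> C \<Longrightarrow> finite (F c)" "J \<subseteq> C" "\<And>j. j \<in> J \<Longrightarrow> v j \<in> F j"
  shows "card {T \<in> PiE C F. \<forall>j\<in>J. T j = v j} * (\<Prod>j\<in>J. card (F j)) = card (PiE C F)"
proof -
  have "{T \<in> PiE C F. \<forall>j\<in>J. T j = v j} = PiE C (\<lambda>c. if c \<in> J then {v c} else F c)" (is "_ = PiE C ?F'")
  proof (intro set_eqI iffI)
    fix T assume "T \<in> PiE C ?F'"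
    then have "T \<in> extensional C" and T: "T c \<in> ?F' c" if "c \<in> C" for c
      using that by (auto simp: PiE_iff)
    moreover have "T c \<in> F c" if "c \<in> C" for c
      using T[OF that] assms(4)[of c] by (cases "c \<in> J") auto
    moreover have "T j = v j" if "j \<in> J" for j
      using T[of j] that assms(3) by auto
    ultimately show "T \<in> {T \<in> PiE C F. \<forall>j\<in>J. T j = v j}"
      using \<open>T \<in> PiE C ?F'\<close> by (auto simp: PiE_iff)
  qed (auto simp: PiE_iff)
  moreover have "card (PiE C ?F') = (\<Prod>c\<in>C - J. card (F c))"
  proof -
    have "card (PiE C ?F') = (\<Prod>c\<in>C. card (?F' c))"
      using assms(1) by (rule card_PiE)
    also have "\<dots> = (\<Prod>c\<in>C - J. card (?F' c)) * (\<Prod>c\<in>J. card (?F' c))"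
      by (rule prod.subset_diff[OF assms(3,1)])
    finally show ?thesis by simp
  qed
  ultimately show ?thesis
    using assms(1) prod.subset_diff[OF assms(3,1), of "\<lambda>c. card (F c)"] by (simp add: card_PiE)
qed

text \<open>By Fubini: once all coordinates except \<open>p\<close> are fixed, equality forces
  coordinate \<open>p\<close> into the single point \<open>U q\<close>, which is null.\<close>

lemma AE_PiM_components_distinct:
  fixes D :: "real measure"
  assumes "prob_space D" "sets D = sets borel" "\<And>x. emeasure D {x} = 0" "finite I"
    and pq: "p \<in> I" "q \<in> I" "p \<noteq> q"
  shows "AE U in PiM I (\<lambda>_. D). U p \<noteq> U q"
proof -
  interpret D: prob_space D by fact
  interpret product_sigma_finite "\<lambda>_. D" ..
  let ?J = "I - {p}" and ?A = "{U \<in> space (PiM I (\<lambda>_. D)). U p = U q}"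
  have [measurable_cong]: "sets D = sets borel" by fact
  have I: "I = insert p ?J" using pq by auto
  have "(\<lambda>U. U p) \<in> PiM I (\<lambda>_. D) \<rightarrow>\<^sub>M D" "(\<lambda>U. U q) \<in> PiM I (\<lambda>_. D) \<rightarrow>\<^sub>M D"
    using pq by (auto intro: measurable_component_singleton)
  then have [measurable]: "(\<lambda>U. U p) \<in> borel_measurable (PiM I (\<lambda>_. D))" "(\<lambda>U. U q) \<in> borel_measurable (PiM I (\<lambda>_. D))"
    using measurable_cong_sets[OF refl assms(2)] by auto
  have A: "?A \<in> sets (PiM I (\<lambda>_. D))" by measurable
  have "emeasure (PiM I (\<lambda>_. D)) ?A = (\<integral>\<^sup>+ U. indicator ?A U \<partial>PiM (insert p ?J) (\<lambda>_. D))"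
    using A I by simp
  also have "\<dots> = (\<integral>\<^sup>+ U. (\<integral>\<^sup>+ y. indicator ?A (U(p := y)) \<partial>D) \<partial>PiM ?J (\<lambda>_. D))"
    using A I assms(4) by (intro product_nn_integral_insert) auto
  also have "\<dots> \<le> (\<integral>\<^sup>+ U. (\<integral>\<^sup>+ y. indicator {U q} y \<partial>D) \<partial>PiM ?J (\<lambda>_. D))"
    using pq by (intro nn_integral_mono) (auto simp: indicator_def)
  also have "\<dots> = 0"
    using assms(2,3) by simp
  finally have "emeasure (PiM I (\<lambda>_. D)) ?A = 0" by simp
  then show ?thesis
    using A by (intro AE_I[of _ _ ?A]) auto
qed

section \<open>Contexts, response tables and payoffs realising them\<close>

locale game_params =
  fixes n :: nat and m :: "nat \<Rightarrow> nat"
  assumes n_ge_2: "2 \<le> n" and m_ge_2: "i < n \<Longrightarrow> 2 \<le> m i"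
begin

text \<open>A context of player \<open>i\<close> (the actions of the other players) is encoded by the profile whose
  \<open>i\<close>-th entry is \<open>0\<close>.\<close>

definition ctx :: "nat \<Rightarrow> (nat \<Rightarrow> nat) set" where
  "ctx i = {c \<in> profiles n m. c i = 0}"

definition slots :: "(nat \<times> (nat \<Rightarrow> nat)) set" where
  "slots = Sigma {0..<n} ctx"

definition tables :: "(nat \<times> (nat \<Rightarrow> nat) \<Rightarrow> nat) set" where
  "tables = PiE slots (\<lambda>p. {0..<m (fst p)})"

definition table :: "payoff \<Rightarrow> nat \<times> (nat \<Rightarrow> nat) \<Rightarrow> nat" where
  "table U = (\<lambda>p\<in>slots. best_resp m U (fst p) (snd p))"

text \<open>A canonical payoff with response table \<open>T\<close>: the prescribed action earns 1,
  every other action 0. It lets the dynamic, which is defined for payoffs, be run on a table. The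
  restriction makes it extensional, as \<open>best_resp_cong_table\<close> requires.\<close>

definition pay :: "(nat \<times> (nat \<Rightarrow> nat) \<Rightarrow> nat) \<Rightarrow> payoff" where
  "pay T = (\<lambda>p\<in>{0..<n} \<times> profiles n m. of_bool (snd p (fst p) = T (fst p, (snd p)(fst p := 0))))"

lemma m_pos: "i < n \<Longrightarrow> 0 < m i"
  using m_ge_2[of i] by simp

lemma n_pos: "0 < n"
  using n_ge_2 by simp

lemma profiles_update: "a \<in> profiles n m \<Longrightarrow> i < n \<Longrightarrow> x < m i \<Longrightarrow> a(i := x) \<in> profiles n m"
  by (auto simp: profiles_def PiE_iff extensional_def)

lemma profiles_update_iff:
  assumes "i < n" "x < m i"
  shows "a(i := x) \<in> profiles n m \<longleftrightarrow> a(i := 0) \<in> profiles n m"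
  using profiles_update[of "a(i := x)" i 0] profiles_update[of "a(i := 0)" i x] assms m_pos[of i]
  by auto

lemma profiles_less: "a \<in> profiles n m \<Longrightarrow> i < n \<Longrightarrow> a i < m i"
  by (auto simp: profiles_def PiE_iff)

lemma finite_profiles [simp]: "finite (profiles n m)"
  by (auto simp: profiles_def intro: finite_PiE)

lemma profiles_nonempty: "profiles n m \<noteq> {}"
  using m_pos by (fastforce simp: profiles_def PiE_eq_empty_iff)

lemma finite_slots [simp]: "finite slots"
  by (auto simp: slots_def ctx_def)

lemma finite_tables [simp]: "finite tables"
  by (auto simp: tables_def intro: finite_PiE)

lemma tables_nonempty: "tables \<noteq> {}"
  using m_pos by (fastforce simp: tables_def slots_def PiE_eq_empty_iff)

lemma slot_of_profile: "a \<in> profiles n m \<Longrightarrow> i < n \<Longrightarrow> (i, a(i := 0)) \<in> slots"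
  using profiles_update[of a i 0] m_pos by (auto simp: slots_def ctx_def)

lemma table_in_tables: "table U \<in> tables"
  using best_resp_maximal m_pos by (auto simp: tables_def table_def slots_def)

lemma best_resp_eq_table:
  "a \<in> profiles n m \<Longrightarrow> i < n \<Longrightarrow> best_resp m U i a = table U (i, a(i := 0))"
  by (simp add: table_def slot_of_profile)

text \<open>Off its index set an extensional payoff is constantly \<open>undefined\<close>, so all
  actions tie and the least one wins. This covers the arguments that are not profiles, over which
  \<open>hit_time_cong\<close> also quantifies.\<close>

lemma best_resp_outside:
  assumes "U \<in> extensional ({0..<n} \<times> profiles n m)" "i < n" "a(i := 0) \<notin> profiles n m"
  shows "best_resp m U i a = 0"
proof -
  have "U (i, a(i := x)) = undefined" if "x < m i" for x
    using assms profiles_update_iff[of i x a] that by (auto simp: extensional_def)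
  then show ?thesis
    using m_pos[OF assms(2)] unfolding best_resp_def by (intro Least_equality) auto
qed

lemma best_resp_cong_table:
  assumes "U \<in> extensional ({0..<n} \<times> profiles n m)" "V \<in> extensional ({0..<n} \<times> profiles n m)"
    and "table U = table V" "i < n"
  shows "best_resp m U i a = best_resp m V i a"
proof (cases "a(i := 0) \<in> profiles n m")
  case True
  then show ?thesis
    using best_resp_eq_table[of "a(i := 0)" i U] best_resp_eq_table[of "a(i := 0)" i V] assms(3,4)
    by simp
qed (simp add: best_resp_outside assms)

lemma best_resp_pay:
  assumes "T \<in> tables" "a \<in> profiles n m" "i < n"
  shows "best_resp m (pay T) i a = T (i, a(i := 0))"
proof (rule best_resp_eqI)
  have "(i, a(i := 0)) \<in> slots" using assms slot_of_profile by auto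
  then show *: "T (i, a(i := 0)) < m i"
    using assms(1) by (force simp: tables_def)
  show "pay T (i, a(i := y)) < pay T (i, a(i := T (i, a(i := 0))))"
    if "y < m i" "y \<noteq> T (i, a(i := 0))" for y
    using that * assms profiles_update by (auto simp: pay_def)
qed

lemma table_pay:
  assumes "T \<in> tables"
  shows "table (pay T) = T"
proof
  fix p
  show "table (pay T) p = T p"
  proof (cases "p \<in> slots")
    case True
    then have "fst p < n" "snd p \<in> profiles n m" "(snd p)(fst p := 0) = snd p"
      by (auto simp: slots_def ctx_def)
    then show ?thesis
      using True assms by (simp add: table_def best_resp_pay)
  next
    case False
    then show ?thesis
      using assms PiE_arb[of T slots _ p] by (auto simp: table_def tables_def)
  qed
qed

lemma hit_time_cong:
  assumes "\<And>i a. i < n \<Longrightarrow> best_resp m U i a = best_resp m V i a"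
  shows "hit_time n m U a = hit_time n m V a"
proof -
  have "clockwork n m U a s = clockwork n m V a s" for s
    using n_pos by (induction s) (auto simp: assms)
  then show ?thesis
    by (simp add: hit_time_def is_PNE_def assms)
qed

text \<open>Reduces the random payoffs to a random element of the finite set
  \<open>tables\<close>.\<close>

lemma hit_time_pay_table:
  assumes "U \<in> extensional ({0..<n} \<times> profiles n m)"
  shows "hit_time n m U a = hit_time n m (pay (table U)) a"
proof (intro hit_time_cong best_resp_cong_table)
  show "pay (table U) \<in> extensional ({0..<n} \<times> profiles n m)"
    by (simp add: pay_def)
qed (use assms in \<open>simp_all add: table_pay table_in_tables\<close>)

end

section \<open>The best-response table is uniformly distributed\<close>

context game_params
begin

text \<open>The event is a finite conjunction over slots, and by \<open>best_resp_eq_iff\<close>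
  each conjunct is a finite Boolean combination of comparisons between coordinates.\<close>

lemma sets_table_eq:
  assumes [measurable_cong]: "sets D = sets borel" and T: "T \<in> tables"
  shows "{U \<in> space (PiM ({0..<n} \<times> profiles n m) (\<lambda>_. D)). table U = T}
    \<in> sets (PiM ({0..<n} \<times> profiles n m) (\<lambda>_. D))" (is "_ \<in> sets ?M")
proof -
  have comp: "(\<lambda>U. U (i, c(i := y))) \<in> borel_measurable ?M"
    if "i < n" "c \<in> profiles n m" "y < m i" for i c y
    using that profiles_update measurable_component_singleton[of "(i, c(i := y))" "{0..<n} \<times> profiles n m" "\<lambda>_. D"]
      measurable_cong_sets[OF refl assms(1)] by auto
  have slot: "{U \<in> space ?M. best_resp m U i c = T (i, c)} \<in> sets ?M" if "(i, c) \<in> slots" for i c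
  proof -
    have i: "i < n" and c: "c \<in> profiles n m" using that by (auto simp: slots_def ctx_def)
    have x: "T (i, c) < m i" using T that by (force simp: tables_def)
    have "{U \<in> space ?M. best_resp m U i c = T (i, c)} =
      {U \<in> space ?M. (\<forall>y\<in>{..<m i}. U (i, c(i := y)) \<le> U (i, c(i := T (i, c)))) \<and>
        (\<forall>z\<in>{..<T (i, c)}. \<exists>y\<in>{..<m i}. U (i, c(i := z)) < U (i, c(i := y)))}"
      using x m_pos[OF i] by (auto simp: best_resp_eq_iff)
    also have "\<dots> \<in> sets ?M"
      using x by (intro sets.sets_Collect_conj sets.sets_Collect_finite_All
          sets.sets_Collect_finite_Ex borel_measurable_le borel_measurable_less comp i c)
        (auto intro!: borel_measurable_le borel_measurable_less comp i c)
    finally show ?thesis .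
  qed
  have "{U \<in> space ?M. table U = T} = {U \<in> space ?M. \<forall>p\<in>slots. best_resp m U (fst p) (snd p) = T p}"
    using T by (auto simp: table_def tables_def fun_eq_iff PiE_iff extensional_def restrict_def)
  also have "\<dots> \<in> sets ?M"
    using slot by (intro sets.sets_Collect_finite_All) auto
  finally show ?thesis .
qed

end

locale atomless_game = game_params +
  fixes D :: "real measure"
  assumes prob_space_D: "prob_space D" and sets_D: "sets D = sets borel"
    and atomless: "emeasure D {x} = 0"
begin

abbreviation payoffs :: "payoff measure" where
  "payoffs \<equiv> PiM ({0..<n} \<times> profiles n m) (\<lambda>_. D)"

lemma prob_space_payoffs: "prob_space payoffs"
  using prob_space_D by (intro prob_space_PiM)

lemma AE_payoffs_inj: "AE U in payoffs. inj_on U ({0..<n} \<times> profiles n m)"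
proof -
  let ?I = "{0..<n} \<times> profiles n m"
  have "AE U in payoffs. \<forall>p\<in>?I. \<forall>q\<in>?I. p \<noteq> q \<longrightarrow> U p \<noteq> U q"
  proof (intro AE_finite_allI)
    fix p q assume "p \<in> ?I" "q \<in> ?I"
    then show "AE U in payoffs. p \<noteq> q \<longrightarrow> U p \<noteq> U q"
      using AE_PiM_components_distinct[OF prob_space_D sets_D atomless, of ?I p q]
      by (cases "p = q") auto
  qed auto
  then show ?thesis
    by (auto simp: inj_on_def elim!: eventually_mono)
qed

text \<open>Swapping, in every context, the payoffs of the actions prescribed by \<open>T\<close> and \<open>T'\<close>
  preserves the payoff distribution and turns the table \<open>T\<close> into \<open>T'\<close>.\<close>

lemma measure_table_le:
  assumes T: "T \<in> tables" and T': "T' \<in> tables"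
  shows "measure payoffs {U \<in> space payoffs. table U = T}
    \<le> measure payoffs {U \<in> space payoffs. table U = T'}"
proof -
  interpret prob_space payoffs by (rule prob_space_payoffs)
  let ?I = "{0..<n} \<times> profiles n m"
  define \<tau> where "\<tau> i c = Transposition.transpose (T (i, c)) (T' (i, c))" for i and c :: "nat \<Rightarrow> nat"
  define \<pi> where "\<pi> p = (fst p, (snd p)(fst p := \<tau> (fst p) ((snd p)(fst p := 0)) (snd p (fst p))))"
    for p :: "nat \<times> (nat \<Rightarrow> nat)"
  define \<phi> where "\<phi> U = (\<lambda>p\<in>?I. U (\<pi> p))" for U :: payoff
  have less: "T (i, c) < m i" "T' (i, c) < m i" if "(i, c) \<in> slots" for i c
    using T T' that by (force simp: tables_def)+
  have \<tau>_less: "\<tau> i c x < m i" if "(i, c) \<in> slots" "x < m i" for i c x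
    using less[OF that(1)] that(2) by (auto simp: \<tau>_def Transposition.transpose_def)
  have \<pi>_I: "\<pi> \<in> ?I \<rightarrow> ?I"
    using slot_of_profile \<tau>_less by (auto simp: \<pi>_def profiles_less intro!: profiles_update)
  \<comment> \<open>\<open>\<pi>\<close> leaves the context unchanged and transposes two actions in
    it, hence is an involution. It therefore permutes i.i.d. coordinates and preserves the product
    measure.\<close>
  have "\<pi> (\<pi> p) = p" for p
    by (simp add: \<pi>_def \<tau>_def)
  then have \<pi>_inj: "inj_on \<pi> ?I"
    by (metis inj_onI)
  have distr: "distr payoffs payoffs \<phi> = payoffs"
    unfolding \<phi>_def using distr_PiM_reindex[OF prob_space_D \<pi>_inj \<pi>_I] by simp
  have \<phi>_meas: "\<phi> \<in> payoffs \<rightarrow>\<^sub>M payoffs"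
    unfolding \<phi>_def using \<pi>_I by (intro measurable_restrict measurable_component_singleton) auto
  have swap: "table (\<phi> U) = T'" if U: "inj_on U ?I" "table U = T" for U
  proof
    fix p
    show "table (\<phi> U) p = T' p"
    proof (cases "p \<in> slots")
      case False
      then show ?thesis
        using T' PiE_arb[of T' slots _ p] by (auto simp: table_def tables_def)
    next
      case True
      obtain i c where p: "p = (i, c)" by (cases p)
      have i: "i < n" and c: "c \<in> profiles n m" and c0: "c(i := 0) = c"
        using True by (auto simp: p slots_def ctx_def)
      note less' = less[OF True[unfolded p]]
      have eq: "\<phi> U (i, c(i := y)) = U (i, c(i := \<tau> i c y))" if "y < m i" for y
        using i c c0 that profiles_update by (simp add: \<phi>_def \<pi>_def)
      have max: "U (i, c(i := y)) \<le> U (i, c(i := T (i, c)))" if "y < m i" for y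
        using best_resp_maximal[of m i U c] that m_pos[OF i] best_resp_eq_table[OF c i, of U] U(2) c0
        by auto
      \<comment> \<open>Strictness comes from injectivity of \<open>U\<close>. With ties the swap
        could fail, since it does not respect the order of actions used to break them.\<close>
      have strict: "U (i, c(i := y)) < U (i, c(i := T (i, c)))" if "y < m i" "y \<noteq> T (i, c)" for y
      proof -
        have "c(i := y) \<noteq> c(i := T (i, c))" using that(2) by (metis fun_upd_same)
        then have "U (i, c(i := y)) \<noteq> U (i, c(i := T (i, c)))"
          using inj_onD[OF U(1), of "(i, c(i := y))" "(i, c(i := T (i, c)))"] i c that less' profiles_update
          by auto
        then show ?thesis using max[OF that(1)] by simp
      qed
      have "best_resp m (\<phi> U) i c = T' (i, c)"
      proof (rule best_resp_eqI)
        fix y assume y: "y < m i" "y \<noteq> T' (i, c)"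
        have "\<tau> i c y \<noteq> T (i, c)"
          using y(2) by (auto simp: \<tau>_def Transposition.transpose_def split: if_splits)
        moreover have "\<tau> i c y < m i" using \<tau>_less True y p by auto
        ultimately show "\<phi> U (i, c(i := y)) < \<phi> U (i, c(i := T' (i, c)))"
          using eq[OF y(1)] eq[OF less'(2)] strict[of "\<tau> i c y"] by (simp add: \<tau>_def)
      qed (use less' in auto)
      then show ?thesis using True p by (simp add: table_def)
    qed
  qed
  have "measure payoffs {U \<in> space payoffs. table U = T}
    \<le> measure payoffs (\<phi> -` {U \<in> space payoffs. table U = T'} \<inter> space payoffs)"
  proof (rule finite_measure_mono_AE)
    show "AE U in payoffs. U \<in> {U \<in> space payoffs. table U = T} \<longrightarrow>
        U \<in> \<phi> -` {U \<in> space payoffs. table U = T'} \<inter> space payoffs"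
      using AE_payoffs_inj by eventually_elim (use swap measurable_space[OF \<phi>_meas] in auto)
  qed (rule measurable_sets[OF \<phi>_meas sets_table_eq[OF sets_D T']])
  also have "\<dots> = measure payoffs {U \<in> space payoffs. table U = T'}"
    using measure_distr[OF \<phi>_meas sets_table_eq[OF sets_D T']] distr by simp
  finally show ?thesis .
qed

text \<open>Applying \<open>measure_table_le\<close> in both directions makes all these events
  equally likely, and they partition the space.\<close>

lemma measure_table:
  assumes "T \<in> tables"
  shows "measure payoffs {U \<in> space payoffs. table U = T} = 1 / card tables"
proof -
  interpret prob_space payoffs by (rule prob_space_payoffs)
  let ?E = "\<lambda>T. {U \<in> space payoffs. table U = T}"
  have "1 = measure payoffs (\<Union>T\<in>tables. ?E T)"
    using table_in_tables prob_space by (auto intro!: arg_cong[where f = prob] simp flip: prob_space)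
  also have "\<dots> = (\<Sum>T'\<in>tables. measure payoffs (?E T'))"
    using sets_table_eq[OF sets_D]
    by (intro finite_measure_finite_Union) (auto simp: disjoint_family_on_def)
  also have "\<dots> = (\<Sum>T'\<in>tables. measure payoffs (?E T))"
    using measure_table_le assms by (intro sum.cong refl antisym) auto
  finally show ?thesis
    using tables_nonempty by (simp add: field_simps)
qed

text \<open>Splitting by the value of the table gives finitely many disjoint rectangles, and both
  the table and the initial profile are uniform. Probabilities thus become proportions of
  pairs.\<close>

lemma game_space_event:
  fixes \<Phi> :: "(nat \<times> (nat \<Rightarrow> nat) \<Rightarrow> nat) \<Rightarrow> (nat \<Rightarrow> nat) \<Rightarrow> bool"
  defines "E \<equiv> {\<omega> \<in> space (game_space n m D). \<Phi> (table (fst \<omega>)) (snd \<omega>)}"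
  shows "E \<in> sets (game_space n m D)"
    and "measure (game_space n m D) E =
      card {(T, a). T \<in> tables \<and> a \<in> profiles n m \<and> \<Phi> T a} / (card tables * card (profiles n m))"
proof -
  interpret A: prob_space payoffs by (rule prob_space_payoffs)
  let ?Q = "measure_pmf (pmf_of_set (profiles n m))"
  interpret Q: prob_space ?Q by (rule measure_pmf.prob_space_axioms)
  interpret pair_prob_space payoffs ?Q ..
  let ?R = "\<lambda>T. {U \<in> space payoffs. table U = T} \<times> {a. \<Phi> T a}"
  have R: "?R T \<in> sets (payoffs \<Otimes>\<^sub>M ?Q)" if "T \<in> tables" for T
    using sets_table_eq[OF sets_D that] by (intro pair_measureI) auto
  have E: "E = (\<Union>T\<in>tables. ?R T)"
    using table_in_tables by (auto simp: E_def game_space_def space_pair_measure)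
  show "E \<in> sets (game_space n m D)"
    unfolding E game_space_def using R by (intro sets.finite_UN) auto
  have "measure (payoffs \<Otimes>\<^sub>M ?Q) E = (\<Sum>T\<in>tables. measure (payoffs \<Otimes>\<^sub>M ?Q) (?R T))"
    unfolding E using R by (intro finite_measure_finite_Union) (auto simp: disjoint_family_on_def)
  also have "\<dots> = (\<Sum>T\<in>tables. 1 / card tables * (card {a \<in> profiles n m. \<Phi> T a} / card (profiles n m)))"
  proof (rule sum.cong[OF refl])
    fix T assume T: "T \<in> tables"
    have "measure (payoffs \<Otimes>\<^sub>M ?Q) (?R T) = measure payoffs {U \<in> space payoffs. table U = T} * measure ?Q {a. \<Phi> T a}"
      using sets_table_eq[OF sets_D T] by (simp add: measure_def measure_pmf.emeasure_pair_measure_Times enn2real_mult)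
    also have "measure ?Q {a. \<Phi> T a} = card {a \<in> profiles n m. \<Phi> T a} / card (profiles n m)"
      using profiles_nonempty by (subst measure_pmf_of_set) (auto simp: Int_def)
    finally show "measure (payoffs \<Otimes>\<^sub>M ?Q) (?R T) = 1 / card tables * (card {a \<in> profiles n m. \<Phi> T a} / card (profiles n m))"
      using measure_table[OF T] by simp
  qed
  also have "\<dots> = real (\<Sum>T\<in>tables. card {a \<in> profiles n m. \<Phi> T a}) / (card tables * card (profiles n m))"
    by (simp add: sum_divide_distrib)
  also have "(\<Sum>T\<in>tables. card {a \<in> profiles n m. \<Phi> T a}) = card (Sigma tables (\<lambda>T. {a \<in> profiles n m. \<Phi> T a}))"
    by (simp add: card_SigmaI)
  also have "Sigma tables (\<lambda>T. {a \<in> profiles n m. \<Phi> T a}) = {(T, a). T \<in> tables \<and> a \<in> profiles n m \<and> \<Phi> T a}"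
    by auto
  finally show "measure (game_space n m D) E =
      card {(T, a). T \<in> tables \<and> a \<in> profiles n m \<and> \<Phi> T a} / (card tables * card (profiles n m))"
    by (simp add: game_space_def)
qed

end

section \<open>Hitting times and equilibrium counts\<close>

lemma sum_card_swap:
  assumes "finite A" "finite B"
  shows "(\<Sum>x\<in>A. card {y \<in> B. R x y}) = (\<Sum>y\<in>B. card {x \<in> A. R x y})"
proof -
  have "card {y \<in> B. R x y} = (\<Sum>y\<in>B. of_bool (R x y))" for x
    using assms by (simp add: Int_def)
  moreover have "card {x \<in> A. R x y} = (\<Sum>x\<in>A. of_bool (R x y))" for y
    using assms by (simp add: Int_def)
  ultimately show ?thesis
    by (simp only: sum.swap[of _ A])
qed

section \<open>Absorption at equilibria and periodicity of the dynamic\<close>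

lemma hit_time_greater_iff:
  "enat t < hit_time n m U a \<longleftrightarrow> (\<forall>s. 1 \<le> s \<and> s \<le> t \<longrightarrow> \<not> is_PNE n m U (clockwork n m U a s))"
  unfolding hit_time_def Suc_ile_eq[symmetric] le_Inf_iff by (auto simp: not_less_eq_eq[symmetric])

lemma hit_time_finite_iff:
  "hit_time n m U a < \<infinity> \<longleftrightarrow> (\<exists>s\<ge>1. is_PNE n m U (clockwork n m U a s))"
  unfolding hit_time_def Inf_less_iff by auto

lemma clockwork_PNE_stays:
  assumes "0 < n" "is_PNE n m U (clockwork n m U a s)"
  shows "clockwork n m U a (s + d) = clockwork n m U a s"
proof (induction d)
  case (Suc d)
  have "(clockwork n m U a s) ((s + d) mod n) = best_resp m U ((s + d) mod n) (clockwork n m U a s)"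
    using assms by (auto simp: is_PNE_def)
  with Suc show ?case by (simp add: fun_upd_idem)
qed simp

text \<open>The profile together with the position in the round determines the future.\<close>

lemma clockwork_shift:
  assumes "clockwork n m U a s = clockwork n m U a s'" "s mod n = s' mod n"
  shows "clockwork n m U a (s + d) = clockwork n m U a (s' + d)"
proof (induction d)
  case (Suc d)
  have "(s + d) mod n = (s' + d) mod n"
    using assms(2) by (metis mod_add_left_eq)
  with Suc show ?case by simp
qed (simp add: assms)

text \<open>If one player meets the same context twice, it answers alike, the two profiles after the
  answers coincide, and the dynamic is periodic from there on. Equilibria are absorbing, so a
  periodic run that ever reaches one already sits in it.\<close>

lemma clockwork_contexts_distinct:
  assumes "0 < n" "enat t < hit_time n m U a" "hit_time n m U a < \<infinity>"
    and s: "s' < s" "s \<le> t" "s mod n = s' mod n"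
  shows "(clockwork n m U a s)(s mod n := 0) \<noteq> (clockwork n m U a s')(s mod n := 0)"
proof
  let ?A = "clockwork n m U a" and ?i = "s mod n"
  assume eq: "(?A s)(?i := 0) = (?A s')(?i := 0)"
  then have "best_resp m U ?i (?A s) = best_resp m U ?i (?A s')"
    by (metis best_resp_update)
  moreover have "(?A s)(?i := x) = (?A s')(?i := x)" for x
    using eq by (metis fun_upd_upd)
  ultimately have step: "?A (Suc s) = ?A (Suc s')"
    using s(3) by simp
  obtain \<tau> where \<tau>: "is_PNE n m U (?A \<tau>)"
    using assms(3) hit_time_finite_iff by blast
  have "?A (Suc s' + j * (s - s')) = ?A (Suc s')" for j
  proof (induction j)
    case (Suc j)
    have "Suc s mod n = Suc s' mod n"
      using s(3) by (metis mod_Suc_eq)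
    then have "?A (Suc s + j * (s - s')) = ?A (Suc s' + j * (s - s'))"
      by (intro clockwork_shift step)
    moreover have "Suc s' + Suc j * (s - s') = Suc s + j * (s - s')"
      using s(1) by simp
    ultimately show ?case using Suc by metis
  qed simp
  \<comment> \<open>As \<open>s - s'\<close> is at least 1, running through \<open>\<tau>\<close>
    periods is enough to pass time \<open>\<tau>\<close>.\<close>
  then have "?A (Suc s' + \<tau> * (s - s')) = ?A (Suc s')" .
  moreover have "\<tau> \<le> Suc s' + \<tau> * (s - s')"
  proof -
    have "\<tau> * 1 \<le> \<tau> * (s - s')" using s(1) by (intro mult_le_mono2) simp
    then show ?thesis by linarith
  qed
  then have "?A (Suc s' + \<tau> * (s - s')) = ?A \<tau>"
    using clockwork_PNE_stays[OF assms(1) \<tau>] by (metis le_add_diff_inverse)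
  ultimately have "is_PNE n m U (?A (Suc s'))"
    using \<tau> by simp
  \<comment> \<open>\<open>Suc s'\<close> lies between 1 and \<open>s\<close>, hence is at most
    \<open>t\<close>.\<close>
  then show False
    using assms(2) s unfolding hit_time_greater_iff by (metis Suc_leI less_le_trans le_add1 plus_1_eq_Suc)
qed

section \<open>Counting tables with prescribed equilibria\<close>

context game_params
begin

lemma clockwork_in_profiles: "a \<in> profiles n m \<Longrightarrow> clockwork n m U a s \<in> profiles n m"
proof (induction s)
  case (Suc s)
  have "s mod n < n" using n_pos by simp
  moreover from this have "best_resp m U (s mod n) (clockwork n m U a s) < m (s mod n)"
    using best_resp_maximal[of m "s mod n"] m_pos by blast
  ultimately show ?case
    unfolding clockwork.simps using Suc by (intro profiles_update)
qed simp

lemma card_profiles: "card (profiles n m) = (\<Prod>i<n. m i)"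
  by (simp add: profiles_def card_PiE lessThan_atLeast0)

text \<open>A context is a profile with one entry pinned. When \<open>m k\<close> is the largest
  action count, \<open>card (ctx k)\<close> is therefore \<open>q_nm n m\<close>.\<close>

lemma card_ctx: "k < n \<Longrightarrow> card (ctx k) * m k = card (profiles n m)"
  using card_PiE_fixed[of "{0..<n}" "\<lambda>i. {0..<m i}" "{k}" "\<lambda>_. 0"] m_pos[of k]
  by (auto simp: ctx_def profiles_def)

lemma card_ctx_ge_2:
  assumes "k < n"
  shows "2 \<le> card (ctx k)"
proof -
  define z where "z = (\<lambda>i\<in>{0..<n}. 0::nat)"
  obtain j where j: "j < n" "j \<noteq> k"
    using n_ge_2 by (metis Suc_le_lessD numeral_2_eq_2 less_trans zero_less_one One_nat_def gr_implies_not0 neq0_conv)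
  have z: "z \<in> profiles n m"
    using m_pos by (auto simp: z_def profiles_def)
  then have "{z, z(j := 1)} \<subseteq> ctx k"
    using j m_ge_2[of j] assms by (auto simp: ctx_def z_def[THEN fun_cong] intro!: profiles_update)
  moreover have "z \<noteq> z(j := 1)"
    using j by (auto simp: z_def fun_eq_iff)
  ultimately show ?thesis
    using card_mono[of "ctx k" "{z, z(j := 1)}"] by (simp add: ctx_def)
qed

lemma card_tables_fixed:
  assumes "J \<subseteq> slots" "\<And>p. p \<in> J \<Longrightarrow> v p < m (fst p)"
  shows "card {T \<in> tables. \<forall>p\<in>J. T p = v p} * (\<Prod>p\<in>J. m (fst p)) = card tables"
  using card_PiE_fixed[of slots "\<lambda>p. {0..<m (fst p)}" J v] assms by (simp add: tables_def)

lemma is_PNE_pay: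
  "T \<in> tables \<Longrightarrow> a \<in> profiles n m \<Longrightarrow> is_PNE n m (pay T) a \<longleftrightarrow> (\<forall>i<n. T (i, a(i := 0)) = a i)"
  by (auto simp: is_PNE_def best_resp_pay)

text \<open>The table entries that decide whether \<open>a\<close> is an equilibrium.\<close>

definition slots_of :: "(nat \<Rightarrow> nat) \<Rightarrow> (nat \<times> (nat \<Rightarrow> nat)) set" where
  "slots_of a = (\<lambda>i. (i, a(i := 0))) ` {0..<n}"

lemma finite_slots_of: "finite (slots_of a)"
  by (simp add: slots_of_def)

lemma slots_of_subset: "a \<in> profiles n m \<Longrightarrow> slots_of a \<subseteq> slots"
  by (auto simp: slots_of_def slot_of_profile)

lemma prod_slots_of: "(\<Prod>p\<in>slots_of a. m (fst p)) = card (profiles n m)"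
  unfolding slots_of_def
    by (subst prod.reindex) (auto simp: inj_on_def card_profiles lessThan_atLeast0)

text \<open>Being an equilibrium prescribes one entry for each player, and the ranges of these
  entries multiply to the number of profiles. So the mean number of equilibria is 1.\<close>

lemma card_tables_PNE:
  assumes "a \<in> profiles n m"
  shows "card {T \<in> tables. is_PNE n m (pay T) a} * card (profiles n m) = card tables"
proof -
  have "{T \<in> tables. is_PNE n m (pay T) a} = {T \<in> tables. \<forall>p\<in>slots_of a. T p = a (fst p)}"
    using assms by (auto simp: is_PNE_pay slots_of_def)
  then show ?thesis
    using card_tables_fixed[of "slots_of a" "\<lambda>p. a (fst p)"] slots_of_subset[OF assms] prod_slots_of[of a]
      profiles_less[OF assms] by (fastforce simp: slots_of_def)
qed

text \<open>Profiles that differ in two coordinates still differ after one coordinate is erased.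
  They share no slot, and the two equilibrium conditions are independent.\<close>

lemma card_tables_two_PNE:
  assumes a: "a \<in> profiles n m" and b: "b \<in> profiles n m" and "a i \<noteq> b i" "a j \<noteq> b j" "i \<noteq> j"
  shows "card {T \<in> tables. is_PNE n m (pay T) a \<and> is_PNE n m (pay T) b} * (card (profiles n m))\<^sup>2 = card tables"
proof -
  have ne: "a(l := 0) \<noteq> b(l := 0)" for l
    using assms(3-5) by (metis fun_upd_other)
  then have disj: "slots_of a \<inter> slots_of b = {}"
    by (auto simp: slots_of_def)
  define v where "v p = (if p \<in> slots_of a then a (fst p) else b (fst p))" for p
  let ?J = "slots_of a \<union> slots_of b"
  have "{T \<in> tables. is_PNE n m (pay T) a \<and> is_PNE n m (pay T) b} = {T \<in> tables. \<forall>p\<in>?J. T p = v p}"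
  proof -
    have "(\<forall>p\<in>?J. T p = v p) \<longleftrightarrow> (\<forall>p\<in>slots_of a. T p = a (fst p)) \<and> (\<forall>p\<in>slots_of b. T p = b (fst p))"
      for T :: "nat \<times> (nat \<Rightarrow> nat) \<Rightarrow> nat"
      using disj by (auto simp: v_def)
    then show ?thesis
      using a b by (auto simp: is_PNE_pay slots_of_def)
  qed
  moreover have "(\<Prod>p\<in>?J. m (fst p)) = (card (profiles n m))\<^sup>2"
    using prod.union_disjoint[of "slots_of a" "slots_of b" "\<lambda>p. m (fst p)"] disj
    by (simp add: prod_slots_of power2_eq_square finite_slots_of)
  moreover have "v p < m (fst p)" if "p \<in> ?J" for p
    using that profiles_less a b by (auto simp: v_def slots_of_def)
  ultimately show ?thesis
    using card_tables_fixed[of ?J v] slots_of_subset a b by auto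
qed

text \<open>Let \<open>N\<close> be the number of equilibria, which has mean \<open>1\<close>, and fix a context \<open>z\<close> of player
  \<open>k\<close>. Since at most one equilibrium has context \<open>z\<close>, the indicator of \<open>N = 0\<close> is at least
  \<open>1 - N\<close> plus the number of pairs consisting of an equilibrium with context \<open>z\<close> and one with
  another context.\<close>

lemma card_tables_no_PNE:
  assumes k: "k < n"
  defines "q \<equiv> card (ctx k)"
  shows "card tables * (m k * ((m k - 1) * (q - 1)))
    \<le> card {T \<in> tables. \<forall>a\<in>profiles n m. \<not> is_PNE n m (pay T) a} * (card (profiles n m))\<^sup>2"
proof -
  let ?M = "card (profiles n m)" and ?Z = "{T \<in> tables. \<forall>a\<in>profiles n m. \<not> is_PNE n m (pay T) a}"
  have fin: "finite (ctx k)" by (simp add: ctx_def)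
  obtain z where z: "z \<in> ctx k"
    using card_ctx_ge_2[OF k] by fastforce
  \<comment> \<open>A triple stands for the pair \<open>z(k := x)\<close>, \<open>c(k := y)\<close>.
    Requiring \<open>x\<close> and \<open>y\<close> to differ makes the two profiles differ at
    \<open>k\<close> as well as in the context, as \<open>card_tables_two_PNE\<close> needs.\<close>
  define X where "X = (SIGMA x:{0..<m k}. ({0..<m k} - {x}) \<times> (ctx k - {z}))"
  let ?E = "\<lambda>T (x, y, c). is_PNE n m (pay T) (z(k := x)) \<and> is_PNE n m (pay T) (c(k := y))"
  have finX: "finite X" using fin by (auto simp: X_def)
  have cardX: "card X = m k * ((m k - 1) * (q - 1))"
    using fin z by (simp add: X_def card_cartesian_product q_def)
  have prof: "c(k := x) \<in> profiles n m" if "c \<in> ctx k" "x < m k" for c x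
    using that k by (auto simp: ctx_def intro: profiles_update)
  \<comment> \<open>The cardinality over \<open>{()}\<close> is the indicator of
    \<open>T \<in> ?Z\<close>, written so that \<open>sum_card_swap\<close> applies to it.\<close>
  have pointwise: "1 + card {p \<in> X. ?E T p} \<le> card {u \<in> {()}. T \<in> ?Z} + card {a \<in> profiles n m. is_PNE n m (pay T) a}"
    if T: "T \<in> tables" for T
  proof (cases "{p \<in> X. ?E T p} = {}")
    case True
    then have "card {p \<in> X. ?E T p} = 0" by (simp only: card.empty)
    moreover have "1 \<le> card {u \<in> {()}. T \<in> ?Z} + card {a \<in> profiles n m. is_PNE n m (pay T) a}"
    proof (cases "T \<in> ?Z")
      case False
      then have "{a \<in> profiles n m. is_PNE n m (pay T) a} \<noteq> {}" using T by auto
      then have "0 < card {a \<in> profiles n m. is_PNE n m (pay T) a}" by (simp add: card_gt_0_iff)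
      then show ?thesis by linarith
    qed simp
    ultimately show ?thesis by linarith
  next
    case False
    let ?N = "{a \<in> profiles n m. is_PNE n m (pay T) a}" and ?b = "z(k := T (k, z))"
    have x: "x = T (k, z)" if "(x, y, c) \<in> X" "?E T (x, y, c)" for x y c
    proof -
      have "z(k := 0) = z" using z by (auto simp: ctx_def)
      moreover have "x < m k" using that by (auto simp: X_def)
      ultimately show ?thesis
        using that(2) is_PNE_pay[OF T prof[OF z, of x]] k by (metis fun_upd_same fun_upd_upd case_prod_conv)
    qed
    \<comment> \<open>The table forces \<open>x\<close>, so a pair is determined by its second
      equilibrium, and this one differs from \<open>?b\<close>.\<close>
    have "card {p \<in> X. ?E T p} \<le> card (?N - {?b})"
    proof (rule card_inj_on_le[where f = "\<lambda>(x, y, c). c(k := y)"])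
      show "inj_on (\<lambda>(x, y, c). c(k := y)) {p \<in> X. ?E T p}"
      proof (rule inj_onI)
        fix p p' assume p: "p \<in> {p \<in> X. ?E T p}" "p' \<in> {p \<in> X. ?E T p}"
          and eq: "(case p of (x, y, c) \<Rightarrow> c(k := y)) = (case p' of (x, y, c) \<Rightarrow> c(k := y))"
        obtain x y c x' y' c' where xy: "p = (x, y, c)" "p' = (x', y', c')"
          by (cases p, cases p')
        have "x = T (k, z)" "x' = T (k, z)" using x p xy by blast+
        moreover have "c(k := 0) = c" "c'(k := 0) = c'" using p xy by (auto simp: X_def ctx_def)
        moreover have "c(k := y) = c'(k := y')" using eq xy by simp
        ultimately show "p = p'"
          unfolding xy by (metis fun_upd_same fun_upd_upd)
      qed
      show "(\<lambda>(x, y, c). c(k := y)) ` {p \<in> X. ?E T p} \<subseteq> ?N - {?b}"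
      proof clarify
        fix x y c assume A: "(x, y, c) \<in> X" "is_PNE n m (pay T) (z(k := x))" "is_PNE n m (pay T) (c(k := y))"
        have "c(k := y) \<in> profiles n m" using A(1) by (auto simp: X_def intro: prof)
        moreover have "y \<noteq> T (k, z)" using x[OF A(1)] A by (auto simp: X_def)
        ultimately show "c(k := y) \<in> ?N - {?b}" using A(3) by (auto dest: fun_cong[of _ _ k])
      qed
    qed auto
    moreover have "?b \<in> ?N"
    proof -
      obtain x y c where A: "(x, y, c) \<in> X" "?E T (x, y, c)" using False by auto
      then have "x < m k" by (auto simp: X_def)
      then show ?thesis using x[OF A] A(2) prof[OF z, of x] by auto
    qed
    then have "0 < card ?N" "card (?N - {?b}) = card ?N - 1"
      by (auto simp: card_gt_0_iff)
    ultimately show ?thesis by linarith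
  qed
  have "card tables + (\<Sum>p\<in>X. card {T \<in> tables. ?E T p}) = (\<Sum>T\<in>tables. 1 + card {p \<in> X. ?E T p})"
    by (subst sum_card_swap[symmetric, OF finite_tables finX]) (simp add: sum_Suc)
  also have "\<dots> \<le> (\<Sum>T\<in>tables. card {u \<in> {()}. T \<in> ?Z} + card {a \<in> profiles n m. is_PNE n m (pay T) a})"
    by (intro sum_mono pointwise)
  also have "\<dots> = card {T \<in> tables. T \<in> ?Z} + (\<Sum>a\<in>profiles n m. card {T \<in> tables. is_PNE n m (pay T) a})"
    unfolding sum.distrib sum_card_swap[OF finite_tables finite_profiles]
      sum_card_swap[of tables "{()}", OF finite_tables finite.insertI[OF finite.emptyI]] by simp
  also have "{T \<in> tables. T \<in> ?Z} = ?Z" by auto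
  finally have main: "card tables + (\<Sum>p\<in>X. card {T \<in> tables. ?E T p})
    \<le> card ?Z + (\<Sum>a\<in>profiles n m. card {T \<in> tables. is_PNE n m (pay T) a})" .
  \<comment> \<open>The mean number of equilibria is 1, so this sum cancels the term
    \<open>card tables\<close> on the left of \<open>main\<close>.\<close>
  have pne: "(\<Sum>a\<in>profiles n m. card {T \<in> tables. is_PNE n m (pay T) a}) = card tables"
  proof -
    have "(\<Sum>a\<in>profiles n m. card {T \<in> tables. is_PNE n m (pay T) a}) * ?M = ?M * card tables"
      by (simp add: sum_distrib_right card_tables_PNE)
    then show ?thesis using profiles_nonempty by (simp add: card_gt_0_iff)
  qed
  have "card {T \<in> tables. ?E T p} * ?M\<^sup>2 = card tables" if p: "p \<in> X" for p
  proof -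
    obtain x y c where p': "p = (x, y, c)" by (cases p)
    have xy: "x < m k" "y < m k" "x \<noteq> y" "c \<in> ctx k" "c \<noteq> z" using p by (auto simp: p' X_def)
    then obtain j where "c j \<noteq> z j" by auto
    moreover then have "j \<noteq> k" using xy z by (auto simp: ctx_def)
    ultimately show ?thesis
      using card_tables_two_PNE[of "z(k := x)" "c(k := y)" j k] prof z xy by (auto simp: p')
  qed
  then have "(\<Sum>p\<in>X. card {T \<in> tables. ?E T p}) * ?M\<^sup>2 = card X * card tables"
    by (simp add: sum_distrib_right)
  then have "card tables * card X = (\<Sum>p\<in>X. card {T \<in> tables. ?E T p}) * ?M\<^sup>2"
    by (simp only: mult.commute)
  also have "\<dots> \<le> card ?Z * ?M\<^sup>2"
    using main pne by (intro mult_le_mono1) linarith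
  finally show ?thesis
    unfolding cardX .
qed

section \<open>The bound for times within the first round\<close>

text \<open>The first step leads to \<open>a(0 := x)\<close> with \<open>x\<close> the answer of
  player 0; conversely, if \<open>a(0 := x)\<close> is an equilibrium, then \<open>x\<close> is that
  answer. Hence one sums \<open>card_tables_PNE\<close> over all \<open>a\<close> and
  \<open>x\<close>.\<close>

lemma card_PNE_at_1:
  "card {(T, a). T \<in> tables \<and> a \<in> profiles n m \<and> is_PNE n m (pay T) (clockwork n m (pay T) a 1)}
    = m 0 * card tables" (is "card ?H = _")
proof -
  let ?M = "card (profiles n m)"
  let ?S = "SIGMA p:(profiles n m \<times> {0..<m 0}). {T \<in> tables. is_PNE n m (pay T) ((fst p)(0 := snd p))}"
  have upd: "a(0 := x) \<in> profiles n m" if "a \<in> profiles n m" "x < m 0" for a x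
    using that n_pos by (intro profiles_update)
  have resp: "best_resp m (pay T) 0 a = x"
    if "is_PNE n m (pay T) (a(0 := x))" for T a x
    using that n_pos unfolding is_PNE_def by (metis best_resp_update fun_upd_same)
  have "bij_betw (\<lambda>(p, T). (T, fst p)) ?S ?H"
    unfolding bij_betw_def
  proof (intro conjI set_eqI iffI)
    show "inj_on (\<lambda>(p, T). (T, fst p)) ?S"
    proof (rule inj_onI, clarsimp)
      fix a x y T
      assume "is_PNE n m (pay T) (a(0 := x))" "is_PNE n m (pay T) (a(0 := y))"
      then show "x = y" using resp by metis
    qed
  next
    fix h assume "h \<in> (\<lambda>(p, T). (T, fst p)) ` ?S"
    then show "h \<in> ?H" using resp by auto
  next
    fix h assume h: "h \<in> ?H"
    obtain T a where "h = (T, a)" by (cases h)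
    with h show "h \<in> (\<lambda>(p, T). (T, fst p)) ` ?S"
      using best_resp_maximal[of m 0 "pay T" a] m_pos[of 0] n_pos
      by (intro image_eqI[of _ _ "((a, best_resp m (pay T) 0 a), T)"]) auto
  qed
  then have "card ?H = card ?S" by (simp add: bij_betw_same_card)
  also have "\<dots> = (\<Sum>p\<in>profiles n m \<times> {0..<m 0}. card {T \<in> tables. is_PNE n m (pay T) ((fst p)(0 := snd p))})"
    by (subst card_SigmaI) auto
  finally have H: "card ?H = (\<Sum>p\<in>profiles n m \<times> {0..<m 0}. card {T \<in> tables. is_PNE n m (pay T) ((fst p)(0 := snd p))})" .
  have "card ?H * ?M = (\<Sum>p\<in>profiles n m \<times> {0..<m 0}. card tables)"
    unfolding H sum_distrib_right
      by (auto simp del: sum_constant intro!: sum.cong card_tables_PNE upd)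
  also have "\<dots> = (m 0 * card tables) * ?M" by simp
  finally have "card ?H * ?M = (m 0 * card tables) * ?M" .
  moreover have "?M \<noteq> 0" using profiles_nonempty by simp
  ultimately show ?thesis by (simp only: mult_cancel2) simp
qed

text \<open>The event is disjoint from two others: that no equilibrium exists, and that one is
  reached at time 1. Those two have total probability at least \<open>1 / (2 * q)\<close>, and
  \<open>1 - x \<le> exp (- x)\<close> finishes.\<close>

lemma hitting_fraction_small_time:
  assumes "1 \<le> t" "k < n"
  shows "real (card {(T, a). T \<in> tables \<and> a \<in> profiles n m \<and>
      enat t < hit_time n m (pay T) a \<and> hit_time n m (pay T) a < \<infinity>}) / (card tables * card (profiles n m))
    \<le> exp (- 1 / (2 * card (ctx k)))" (is "real (card ?G) / _ \<le> _")
proof -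
  let ?Z = "{T \<in> tables. \<forall>a\<in>profiles n m. \<not> is_PNE n m (pay T) a}"
  let ?H = "{(T, a). T \<in> tables \<and> a \<in> profiles n m \<and> is_PNE n m (pay T) (clockwork n m (pay T) a 1)}"
  define \<theta> M q \<mu> where "\<theta> = real (card tables)" and "M = real (card (profiles n m))"
    and "q = real (card (ctx k))" and "\<mu> = real (m k)"
  have pos: "\<theta> > 0" "M > 0"
    using tables_nonempty profiles_nonempty by (simp_all add: \<theta>_def M_def card_gt_0_iff)
  have q2: "q \<ge> 2" and \<mu>2: "\<mu> \<ge> 2"
    using card_ctx_ge_2[OF assms(2)] m_ge_2[OF assms(2)] by (simp_all add: q_def \<mu>_def)
  have M: "M = q * \<mu>"
    using card_ctx[OF assms(2)] by (simp add: M_def q_def \<mu>_def flip: of_nat_mult)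
  have fin: "finite (tables \<times> profiles n m)" by simp
  have sub: "?G \<subseteq> tables \<times> profiles n m" "?Z \<times> profiles n m \<subseteq> tables \<times> profiles n m" "?H \<subseteq> tables \<times> profiles n m"
    by auto
  have "?G \<inter> (?Z \<times> profiles n m) = {}"
    using clockwork_in_profiles unfolding hit_time_finite_iff by blast
  moreover have "(?G \<union> ?Z \<times> profiles n m) \<inter> ?H = {}"
  proof -
    have "?G \<inter> ?H = {}" using assms(1) by (auto simp: hit_time_greater_iff)
    moreover have "(?Z \<times> profiles n m) \<inter> ?H = {}" using clockwork_in_profiles by blast
    ultimately show ?thesis by blast
  qed
  ultimately have "card ?G + card (?Z \<times> profiles n m) + card ?H = card (?G \<union> ?Z \<times> profiles n m \<union> ?H)"
    using sub by (simp only: card_Un_disjoint finite_subset[OF _ fin] Un_subset_iff)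
  also have "\<dots> \<le> card (tables \<times> profiles n m)"
    using sub by (intro card_mono fin) auto
  finally have "real (card ?G + card (?Z \<times> profiles n m) + card ?H) \<le> real (card (tables \<times> profiles n m))"
    by (rule of_nat_mono)
  then have 1: "real (card ?G) + real (card ?Z) * M + real (m 0) * \<theta> \<le> \<theta> * M"
    unfolding card_PNE_at_1 by (simp add: card_cartesian_product \<theta>_def M_def)
  have "real (card tables * (m k * ((m k - 1) * (card (ctx k) - 1)))) \<le> real (card ?Z * (card (profiles n m))\<^sup>2)"
    using card_tables_no_PNE[OF assms(2)] by (rule of_nat_mono)
  then have "\<theta> * (\<mu> * ((\<mu> - 1) * (q - 1))) \<le> real (card ?Z) * M * M"
    using q2 \<mu>2 by (simp add: \<theta>_def M_def q_def \<mu>_def of_nat_diff power2_eq_square mult.assoc)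
  then have 2: "\<theta> * (\<mu> - 1) * (q - 1) / q \<le> real (card ?Z) * M"
  proof -
    assume "\<theta> * (\<mu> * ((\<mu> - 1) * (q - 1))) \<le> real (card ?Z) * M * M"
    also have "\<dots> = real (card ?Z) * M * q * \<mu>" by (simp add: M)
    finally have "(\<theta> * (\<mu> - 1) * (q - 1)) * \<mu> \<le> (real (card ?Z) * M * q) * \<mu>"
      by (simp add: mult_ac)
    then show ?thesis
      using q2 \<mu>2 by (simp add: pos_divide_le_eq)
  qed
  have "2 * \<theta> \<le> real (m 0) * \<theta>"
    using m_ge_2[of 0] n_pos pos by (intro mult_right_mono) auto
  with 1 2 have "real (card ?G) \<le> \<theta> * M - \<theta> * (\<mu> - 1) * (q - 1) / q - 2 * \<theta>"
    by linarith
  also have "\<dots> = \<theta> * M * (1 - ((\<mu> - 1) * (q - 1) / q + 2) / M)"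
    using pos by (simp add: field_simps)
  \<comment> \<open>As \<open>q \<ge> 2\<close>, the numerator is at least
    \<open>(\<mu> - 1) / 2 + 2\<close>, hence at least \<open>\<mu> / 2\<close>, while
    \<open>M = q * \<mu>\<close>.\<close>
  also have "((\<mu> - 1) * (q - 1) / q + 2) / M \<ge> 1 / (2 * q)"
  proof -
    have "(\<mu> - 1) * (1 / 2) \<le> (\<mu> - 1) * ((q - 1) / q)"
      using q2 \<mu>2 by (intro mult_left_mono) (auto simp: field_simps)
    then have "\<mu> / 2 \<le> (\<mu> - 1) * (q - 1) / q + 2" by simp
    then have "\<mu> / 2 / M \<le> ((\<mu> - 1) * (q - 1) / q + 2) / M"
      using pos by (intro divide_right_mono) auto
    then show ?thesis using q2 \<mu>2 by (simp add: M)
  qed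
  then have "\<theta> * M * (1 - ((\<mu> - 1) * (q - 1) / q + 2) / M) \<le> \<theta> * M * (1 - 1 / (2 * q))"
    using pos by (intro mult_left_mono) auto
  finally have "real (card ?G) / (\<theta> * M) \<le> 1 + - 1 / (2 * q)"
    using pos by (simp add: pos_divide_le_eq mult.commute)
  also have "\<dots> \<le> exp (- 1 / (2 * q))" by (rule exp_ge_add_one_self)
  finally show ?thesis by (simp add: \<theta>_def M_def q_def)
qed

end

section \<open>Trajectories as words\<close>

lemma prod_lessThan_add: "(\<Prod>s<a + b. f s) = (\<Prod>s<a. f s) * (\<Prod>s<b. f (a + s))" for a b :: nat
  by (induction b) (simp_all add: mult.assoc)

text \<open>The birthday estimate: each factor is at most \<open>exp (- r / q)\<close>, and the
  exponents sum to a triangular number. For \<open>r > q\<close> the truncated difference is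
  0.\<close>

lemma prod_falling_le_exp:
  fixes q R :: nat
  assumes "0 < q"
  shows "(\<Prod>r<R. real (q - r) / real q) \<le> exp (- (real R * (real R - 1)) / (2 * real q))"
proof -
  have "(\<Prod>r<R. real (q - r) / real q) \<le> (\<Prod>r<R. exp (- real r / real q))"
  proof (intro prod_mono conjI)
    fix r
    show "real (q - r) / real q \<le> exp (- real r / real q)"
    proof (cases "r \<le> q")
      case True
      then have "real (q - r) / real q = 1 + - real r / real q"
        using assms by (simp add: of_nat_diff field_simps)
      then show ?thesis using exp_ge_add_one_self[of "- real r / real q"] by simp
    qed simp
  qed auto
  also have "\<dots> = exp (- (real R * (real R - 1)) / (2 * real q))"
    using assms by (induction R) (simp_all add: field_simps flip: exp_add)
  finally show ?thesis .
qed

lemma mod_add_round: "(k + n * x + j) mod n = (k + j) mod n" for k n x j :: nat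
  using mod_mult_self2[of "k + j" n x] by (simp add: add_ac)

lemma mod_add_bij_betw:
  fixes k n :: nat
  assumes "0 < n"
  shows "bij_betw (\<lambda>j. (k + j) mod n) {..<n} {..<n}"
proof -
  have "inj_on (\<lambda>j. (k + j) mod n) {..<n}"
  proof (rule inj_onI)
    fix j j' assume "j \<in> {..<n}" "j' \<in> {..<n}" "(k + j) mod n = (k + j') mod n"
    then have "int j mod int n = int j' mod int n"
      by (metis add_diff_cancel_left' mod_diff_left_eq of_nat_add zmod_int)
    then show "j = j'" using \<open>j \<in> _\<close> \<open>j' \<in> _\<close> by simp
  qed
  moreover from this have "(\<lambda>j. (k + j) mod n) ` {..<n} = {..<n}"
    using assms by (intro endo_inj_surj) auto
  ultimately show ?thesis by (simp add: bij_betw_def)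
qed

context game_params
begin

text \<open>A word records the initial profile in its first \<open>n\<close> letters, followed by the successive
  responses; \<open>state w s\<close> is the profile after \<open>s\<close> steps.\<close>

definition words :: "nat \<Rightarrow> (nat \<Rightarrow> nat) set" where
  "words N = PiE {..<N} (\<lambda>s. {0..<m (s mod n)})"

primrec state :: "(nat \<Rightarrow> nat) \<Rightarrow> nat \<Rightarrow> nat \<Rightarrow> nat" where
  "state w 0 = restrict w {0..<n}"
| "state w (Suc s) = (state w s)(s mod n := w (n + s))"

text \<open>The word of an actual run: from position \<open>n\<close> on, letter \<open>s\<close> is
  the entry written by the step from time \<open>s - n\<close> to
  \<open>Suc (s - n)\<close>.\<close>

definition traj :: "payoff \<Rightarrow> (nat \<Rightarrow> nat) \<Rightarrow> nat \<Rightarrow> nat" where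
  "traj U a s = (if s < n then a s else clockwork n m U a (Suc (s - n)) ((s - n) mod n))"

text \<open>The context that player \<open>k\<close> faces at time \<open>k + n * r\<close>, read
  off the word in the cyclic order of the other players. The omitted offset 0 is the action of
  \<open>k\<close> itself.\<close>

definition window :: "nat \<Rightarrow> (nat \<Rightarrow> nat) \<Rightarrow> nat \<Rightarrow> nat \<Rightarrow> nat" where
  "window k w r = (\<lambda>j\<in>{1..<n}. w (k + n * r + j))"

lemma finite_words [simp]: "finite (words N)"
  by (auto simp: words_def intro: finite_PiE)

lemma card_words: "card (words N) = (\<Prod>s<N. m (s mod n))"
  by (simp add: words_def card_PiE)

text \<open>The profile at time \<open>s\<close> consists of the \<open>n\<close> consecutive
  letters from position \<open>s\<close>: each step discards the oldest letter and writes letter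
  \<open>n + s\<close> for the same player.\<close>

lemma state_eq_letter: "j < n \<Longrightarrow> state w s ((s + j) mod n) = w (s + j)"
proof (induction s arbitrary: j)
  case (Suc s)
  show ?case
  proof (cases "Suc j = n")
    case True
    then have "Suc s + j = n + s" by simp
    then show ?thesis by (simp only: state.simps) simp
  next
    case False
    then have "Suc j < n" using Suc.prems by simp
    moreover have "(s + Suc j) mod n \<noteq> s mod n"
      using inj_onD[OF bij_betw_imp_inj_on[OF mod_add_bij_betw[OF n_pos, of s]], of "Suc j" 0]
        \<open>Suc j < n\<close> n_pos by auto
    ultimately show ?thesis using Suc.IH[of "Suc j"] by simp
  qed
qed simp

lemma state_extensional: "state w s \<in> extensional {0..<n}"
  using n_pos by (induction s) (auto simp: extensional_def)

lemma state_traj: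
  assumes "a \<in> profiles n m" "n + s \<le> N"
  shows "state (restrict (traj U a) {..<N}) s = clockwork n m U a s"
  using assms(2)
proof (induction s)
  case 0
  have "a \<in> extensional {0..<n}" using assms(1) by (simp add: profiles_def PiE_iff)
  with 0 show ?case by (auto simp: traj_def fun_eq_iff extensional_def)
next
  case (Suc s)
  then show ?case by (simp add: traj_def)
qed

lemma traj_in_words: "a \<in> profiles n m \<Longrightarrow> restrict (traj U a) {..<N} \<in> words N"
  using clockwork_in_profiles[of a U] n_pos profiles_less
  by (auto simp: words_def traj_def le_mod_geq simp del: clockwork.simps)

text \<open>The offsets 1 to \<open>n - 1\<close> after \<open>k\<close>, taken modulo
  \<open>n\<close>, run through all the other players.\<close>

lemma window_determines_context:
  assumes "k < n" "window k w r = window k w r'"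
  shows "(state w (k + n * r))(k := 0) = (state w (k + n * r'))(k := 0)"
proof
  fix i
  show "((state w (k + n * r))(k := 0)) i = ((state w (k + n * r'))(k := 0)) i"
  proof (cases "i < n \<and> i \<noteq> k")
    case True
    then have "i \<in> (\<lambda>j. (k + j) mod n) ` {..<n}"
      using bij_betw_imp_surj_on[OF mod_add_bij_betw[OF n_pos, of k]] by simp
    then obtain j where j: "j < n" "i = (k + j) mod n"
      by auto
    then have "j \<in> {1..<n}" using True assms(1) by (cases j) auto
    then have "w (k + n * r + j) = w (k + n * r' + j)"
      using fun_cong[OF assms(2), of j] by (simp add: window_def)
    moreover have "i = (k + n * x + j) mod n" for x
      by (simp only: j(2) mod_add_round)
    ultimately show ?thesis
      using True state_eq_letter[OF j(1), of w "k + n * r"] state_eq_letter[OF j(1), of w "k + n * r'"]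
      by simp
  next
    case False
    then show ?thesis
      using state_extensional[of w] by (auto simp: extensional_def)
  qed
qed

section \<open>Counting words with distinct windows\<close>

text \<open>The possible values of a window of player \<open>k\<close>.\<close>

definition blocks :: "nat \<Rightarrow> (nat \<Rightarrow> nat) set" where
  "blocks k = PiE {1..<n} (\<lambda>j. {0..<m ((k + j) mod n)})"

lemma prod_rotate: "(\<Prod>j<n. m ((k + j) mod n)) = card (profiles n m)"
  using prod.reindex_bij_betw[OF mod_add_bij_betw[OF n_pos, of k], of m] by (simp add: card_profiles)

lemma card_blocks:
  assumes "k < n"
  shows "card (blocks k) = card (ctx k)"
proof -
  have "{..<n} = insert 0 {1..<n}" using n_pos by auto
  then have "card (ctx k) * m k = card (blocks k) * m k"
    using prod_rotate[of k] card_ctx[OF assms] assms by (simp add: blocks_def card_PiE mult.commute)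
  then show ?thesis using m_pos[OF assms] by simp
qed

lemma finite_blocks: "finite (blocks k)"
  by (auto simp: blocks_def intro: finite_PiE)

text \<open>After the first \<open>k\<close> letters, every further \<open>n\<close> letters contain
  exactly one of each player.\<close>

lemma card_words_rounds:
  assumes "k < n"
  shows "card (words (k + n * R)) = (\<Prod>s<k. m s) * (m k * card (ctx k)) ^ R"
proof (induction R)
  case (Suc R)
  have "card (words (k + n * Suc R)) = card (words (k + n * R)) * (\<Prod>j<n. m ((k + n * R + j) mod n))"
    using prod_lessThan_add[of "\<lambda>s. m (s mod n)" "k + n * R" n] by (simp add: card_words add_ac)
  also have "(\<Prod>j<n. m ((k + n * R + j) mod n)) = (\<Prod>j<n. m ((k + j) mod n))"
    by (simp only: mod_add_round)
  finally show ?case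
    using card_ctx[OF assms] unfolding Suc prod_rotate by (simp add: mult_ac)
qed (use assms in \<open>simp add: card_words\<close>)

text \<open>Each new round brings one free letter of player \<open>k\<close> and a window that must
  avoid the \<open>R\<close> blocks already used.\<close>

lemma card_words_distinct_windows:
  assumes k: "k < n"
  shows "card {w \<in> words (k + n * R). inj_on (window k w) {..<R}}
    \<le> (\<Prod>s<k. m s) * m k ^ R * (\<Prod>r<R. card (ctx k) - r)"
proof (induction R)
  case 0
  then show ?case using k by (simp add: card_words)
next
  case (Suc R)
  let ?N = "k + n * R" and ?q = "card (ctx k)"
  let ?A = "\<lambda>R. {w \<in> words (k + n * R). inj_on (window k w) {..<R}}"
  let ?f = "\<lambda>w. (restrict w {..<?N}, w ?N, window k w R)"
  let ?B = "SIGMA w:?A R. {0..<m k} \<times> (blocks k - window k w ` {..<R})"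
  \<comment> \<open>Windows of earlier rounds end before position \<open>?N\<close>, so the prefix
    determines them.\<close>
  have earlier: "window k (restrict w {..<?N}) r = window k w r" if "r < R" for w r
  proof
    fix j
    have "n * r + n \<le> n * R" using that by (metis Suc_leI mult_Suc_right mult_le_mono2 add.commute)
    then have "k + n * r + j < ?N" if "j < n" using that by linarith
    then show "window k (restrict w {..<?N}) r j = window k w r j"
      by (simp add: window_def)
  qed
  have "card (?A (Suc R)) \<le> card ?B"
  proof (rule card_inj_on_le[of ?f])
    show "inj_on ?f (?A (Suc R))"
    proof (rule inj_onI)
      fix w w' assume w: "w \<in> ?A (Suc R)" "w' \<in> ?A (Suc R)" and eq: "?f w = ?f w'"
      show "w = w'"
      proof
        fix s
        consider "s < ?N" | "s = ?N" | j where "s = ?N + j" "j \<in> {1..<n}" | "\<not> s < k + n * Suc R"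
        proof -
          have "s = ?N + (s - ?N)" "s - ?N \<in> {1..<n}" if "\<not> s < ?N" "s \<noteq> ?N" "s < k + n * Suc R"
            using that by auto
          then show thesis using that by blast
        qed
        then show "w s = w' s"
        proof cases
          case 1
          moreover have "restrict w {..<?N} s = restrict w' {..<?N} s" using eq by simp
          ultimately show ?thesis by simp
        next
          case 3
          moreover have "window k w R j = window k w' R j" using eq by simp
          ultimately show ?thesis by (simp add: window_def)
        next
          case 4
          then show ?thesis using w unfolding words_def by (auto simp: PiE_iff extensional_def)
        qed (use eq in auto)
      qed
    qed
    show "?f ` ?A (Suc R) \<subseteq> ?B"
    proof (rule image_subsetI)
      fix w assume "w \<in> ?A (Suc R)"
      then have w: "w \<in> words (k + n * Suc R)" "inj_on (window k w) {..<Suc R}"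
        by auto
      have letter: "w s < m (s mod n)" if "s < k + n * Suc R" for s
        using w(1) that by (auto simp: words_def PiE_iff)
      have "restrict w {..<?N} \<in> words ?N"
        using letter by (auto simp: words_def)
      moreover have "inj_on (window k (restrict w {..<?N})) {..<R}"
        using w(2) earlier by (auto simp: inj_on_def)
      moreover have "w ?N < m k"
        using letter[of ?N] k n_pos by simp
      moreover have "window k w R \<in> blocks k"
      proof -
        have "w (?N + j) < m ((k + j) mod n)" if "j < n" for j
          using letter[of "?N + j"] that by (simp add: mod_add_round)
        then show ?thesis by (auto simp: blocks_def window_def)
      qed
      moreover have "window k w R \<notin> window k (restrict w {..<?N}) ` {..<R}"
      proof
        assume "window k w R \<in> window k (restrict w {..<?N}) ` {..<R}"
        then obtain r where "r < R" "window k w R = window k w r" using earlier by auto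
        then show False using inj_onD[OF w(2), of R r] by simp
      qed
      ultimately show "?f w \<in> ?B"
        by auto
    qed
    show "finite ?B" using finite_blocks by auto
  qed
  also have "\<dots> = (\<Sum>w\<in>?A R. m k * (?q - R))"
  proof (subst card_SigmaI)
    show "(\<Sum>w\<in>?A R. card ({0..<m k} \<times> (blocks k - window k w ` {..<R}))) = (\<Sum>w\<in>?A R. m k * (?q - R))"
    proof (rule sum.cong[OF refl])
      fix w assume w: "w \<in> ?A R"
      have "window k w ` {..<R} \<subseteq> blocks k"
      proof clarify
        fix r assume "r < R"
        then have "n * r + n \<le> n * R" by (metis Suc_leI mult_Suc_right mult_le_mono2 add.commute)
        then have "w (k + n * r + j) < m ((k + n * r + j) mod n)" if "j < n" for j
          using w that by (simp add: words_def PiE_iff)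
        then have "w (k + n * r + j) < m ((k + j) mod n)" if "j < n" for j
          using that by (simp only: mod_add_round)
        then show "window k w r \<in> blocks k" by (auto simp: blocks_def window_def)
      qed
      moreover have "card (window k w ` {..<R}) = R"
        using w by (simp add: card_image)
      ultimately have "card (blocks k - window k w ` {..<R}) = ?q - R"
        by (simp add: card_Diff_subset card_blocks[OF k])
      then show "card ({0..<m k} \<times> (blocks k - window k w ` {..<R})) = m k * (?q - R)"
        by (simp add: card_cartesian_product)
    qed
  qed (use finite_blocks in auto)
  also have "\<dots> = card (?A R) * (m k * (?q - R))" by simp
  also have "\<dots> \<le> ((\<Prod>s<k. m s) * m k ^ R * (\<Prod>r<R. ?q - r)) * (m k * (?q - R))"
    by (intro mult_le_mono1 Suc.IH)
  finally show ?case by (simp add: mult_ac)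
qed

section \<open>The birthday bound for complete rounds\<close>

text \<open>The word determines the initial profile, the slots queried in the first \<open>L\<close>
  steps and the answers. On the hitting event these slots are distinct, so \<open>L\<close> separate
  table entries are prescribed.\<close>

lemma card_trajectory_fibre:
  assumes "L \<le> t"
  shows "card {(T, a). T \<in> tables \<and> a \<in> profiles n m \<and> enat t < hit_time n m (pay T) a \<and>
      hit_time n m (pay T) a < \<infinity> \<and> restrict (traj (pay T) a) {..<n + L} = w} * (\<Prod>s<L. m (s mod n))
    \<le> card tables" (is "card ?F * _ \<le> _")
proof (cases "?F = {}")
  case True
  then show ?thesis by (simp only: card.empty)
next
  case False
  define qu where "qu s = (s mod n, (state w s)(s mod n := 0))" for s
  \<comment> \<open>The answer that the word records for slot \<open>p\<close>; it is unambiguous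
    once \<open>qu\<close> is shown injective.\<close>
  define v where "v p = w (n + the_inv_into {..<L} qu p)" for p
  have st: "state w s = clockwork n m (pay T) a s" if "(T, a) \<in> ?F" "s \<le> L" for T a s
    using that state_traj[of a s "n + L" "pay T"] by auto
  \<comment> \<open>The queries \<open>qu\<close> depend on \<open>w\<close> alone, so one member of
    the fibre suffices to show that they are distinct and lie in \<open>slots\<close>.\<close>
  obtain T0 a0 where F0: "(T0, a0) \<in> ?F" using False by auto
  have prof: "state w s \<in> profiles n m" if "s \<le> L" for s
    using st[OF F0 that] F0 clockwork_in_profiles by auto
  have w: "w \<in> words (n + L)"
    using F0 traj_in_words by auto
  have inj: "inj_on qu {..<L}"
  proof (rule linorder_inj_onI')
    fix s' s assume s: "s' \<in> {..<L}" "s \<in> {..<L}" "s' < s"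
    show "qu s' \<noteq> qu s"
    proof
      assume eq: "qu s' = qu s"
      then have "s mod n = s' mod n" "(clockwork n m (pay T0) a0 s)(s mod n := 0) = (clockwork n m (pay T0) a0 s')(s mod n := 0)"
        using st[OF F0, of s] st[OF F0, of s'] s by (auto simp: qu_def)
      then show False
        using clockwork_contexts_distinct[OF n_pos, of t m "pay T0" a0 s' s] F0 s assms by auto
    qed
  qed
  have v: "v (qu s) = w (n + s)" if "s < L" for s
    using that inj by (simp add: v_def the_inv_into_f_f)
  let ?J = "qu ` {..<L}"
  have J: "(\<Prod>s<L. m (s mod n)) = (\<Prod>p\<in>?J. m (fst p))"
    using inj by (subst prod.reindex) (auto simp: qu_def)
  have "?F \<subseteq> {T \<in> tables. \<forall>p\<in>?J. T p = v p} \<times> {restrict w {0..<n}}"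
  proof (rule subrelI)
    fix T a assume F: "(T, a) \<in> ?F"
    then have T: "T \<in> tables" and weq: "w = restrict (traj (pay T) a) {..<n + L}"
      by auto
    have "a = restrict w {0..<n}"
      using st[OF F, of 0] by simp
    moreover
    have "T (qu s) = v (qu s)" if s: "s < L" for s
    proof -
      have "w (n + s) = clockwork n m (pay T) a (Suc s) (s mod n)"
        using s by (simp add: weq traj_def)
      also have "\<dots> = best_resp m (pay T) (s mod n) (state w s)"
        using st[OF F, of s] s by simp
      also have "\<dots> = T (qu s)"
        using best_resp_pay[OF T prof, of s "s mod n"] s n_pos by (simp add: qu_def)
      finally show ?thesis using v s by simp
    qed
    ultimately show "(T, a) \<in> {T \<in> tables. \<forall>p\<in>?J. T p = v p} \<times> {restrict w {0..<n}}"
      using T by auto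
  qed
  then have "card ?F \<le> card ({T \<in> tables. \<forall>p\<in>?J. T p = v p} \<times> {restrict w {0..<n}})"
    by (intro card_mono) auto
  then have "card ?F * (\<Prod>s<L. m (s mod n)) \<le> card {T \<in> tables. \<forall>p\<in>?J. T p = v p} * (\<Prod>s<L. m (s mod n))"
    by (simp add: card_cartesian_product)
  also have "card {T \<in> tables. \<forall>p\<in>?J. T p = v p} * (\<Prod>s<L. m (s mod n)) = card tables"
    unfolding J
  proof (rule card_tables_fixed)
    show "?J \<subseteq> slots"
      using prof n_pos slot_of_profile by (auto simp: qu_def)
    fix p assume "p \<in> ?J"
    then obtain s where s: "s < L" "p = qu s" by auto
    have "w (n + s) \<in> {0..<m ((n + s) mod n)}"
      using PiE_mem[OF w[unfolded words_def], of "n + s"] s(1) by simp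
    then show "v p < m (fst p)" using v s by (simp add: qu_def)
  qed
  finally show ?thesis .
qed

text \<open>Player \<open>k\<close> moves at times \<open>k\<close>, \<open>k + n\<close>, ...,
  \<open>k + n * (R - 1)\<close>, all at most \<open>t\<close>, so its first \<open>R\<close>
  windows are distinct. Summing the fibre bound over such words compares their number with that of
  all words.\<close>

lemma hitting_fraction_rounds:
  assumes k: "k < n" and R: "1 \<le> R" "k + n * (R - 1) \<le> t"
  shows "real (card {(T, a). T \<in> tables \<and> a \<in> profiles n m \<and>
      enat t < hit_time n m (pay T) a \<and> hit_time n m (pay T) a < \<infinity>}) / (card tables * card (profiles n m))
    \<le> exp (- (real R * (real R - 1)) / (2 * card (ctx k)))" (is "real (card ?G) / _ \<le> _")
proof -
  \<comment> \<open>The time at which \<open>k\<close> faces its \<open>R\<close>-th context; the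
    \<open>n + L\<close> letters known by then end exactly with window \<open>R - 1\<close>.\<close>
  define L where "L = k + n * (R - 1)"
  let ?q = "card (ctx k)" and ?N = "n + L"
  let ?W = "{w \<in> words ?N. inj_on (window k w) {..<R}}"
  let ?F = "\<lambda>w. {(T, a). T \<in> tables \<and> a \<in> profiles n m \<and> enat t < hit_time n m (pay T) a \<and>
      hit_time n m (pay T) a < \<infinity> \<and> restrict (traj (pay T) a) {..<?N} = w}"
  have N: "?N = k + n * R"
    using R(1) by (cases R) (simp_all add: L_def)
  define \<rho> where "\<rho> = (\<Prod>s<L. m (s mod n))"
  have "\<rho> > 0" using m_pos n_pos by (auto simp: \<rho>_def intro!: prod_pos)
  have q: "?q > 0" using card_ctx_ge_2[OF k] by simp
  have "?G \<subseteq> (\<Union>w\<in>?W. ?F w)"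
  proof clarify
    fix T a assume A: "T \<in> tables" "a \<in> profiles n m" "enat t < hit_time n m (pay T) a"
      "hit_time n m (pay T) a < \<infinity>"
    define w where "w = restrict (traj (pay T) a) {..<?N}"
    have "inj_on (window k w) {..<R}"
    proof (rule linorder_inj_onI')
      fix r' r assume r: "r' \<in> {..<R}" "r \<in> {..<R}" "r' < r"
      show "window k w r' \<noteq> window k w r"
      proof
        assume eq: "window k w r' = window k w r"
        have le: "k + n * x \<le> L" if "x < R" for x
          unfolding L_def using that by (intro add_left_mono mult_le_mono2) simp
        have "state w (k + n * x) = clockwork n m (pay T) a (k + n * x)" if "x < R" for x
          using state_traj[OF A(2), of "k + n * x" ?N "pay T"] le[OF that] by (simp add: w_def)
        then have "(clockwork n m (pay T) a (k + n * r))(k := 0) = (clockwork n m (pay T) a (k + n * r'))(k := 0)"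
          using window_determines_context[OF k eq] r by simp
        moreover have "k + n * r' < k + n * r" using r n_pos by simp
        moreover have "k + n * r \<le> t"
          using le[of r] r(2) R(2) unfolding L_def by (meson lessThan_iff le_trans)
        ultimately show False
          using clockwork_contexts_distinct[OF n_pos A(3,4), of "k + n * r'" "k + n * r"] k by simp
      qed
    qed
    moreover have "w \<in> words ?N" unfolding w_def by (rule traj_in_words[OF A(2)])
    ultimately show "(T, a) \<in> (\<Union>w\<in>?W. ?F w)" using A w_def by auto
  qed
  moreover have finF: "finite (?F w)" for w
    by (rule finite_subset[of _ "tables \<times> profiles n m"]) auto
  ultimately have "card ?G \<le> card (\<Union>w\<in>?W. ?F w)"
    by (intro card_mono) auto
  also have "\<dots> \<le> (\<Sum>w\<in>?W. card (?F w))"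
    by (intro card_UN_le) auto
  finally have "card ?G * \<rho> \<le> (\<Sum>w\<in>?W. card (?F w) * \<rho>)"
    by (simp add: sum_distrib_right[symmetric])
  also have "\<dots> \<le> (\<Sum>w\<in>?W. card tables)"
    unfolding \<rho>_def by (intro sum_mono card_trajectory_fibre) (use R L_def in auto)
  finally have "card ?G * \<rho> \<le> card ?W * card tables" by simp
  also have "\<dots> \<le> ((\<Prod>s<k. m s) * m k ^ R * (\<Prod>r<R. ?q - r)) * card tables"
    using card_words_distinct_windows[OF k, of R] unfolding N by (rule mult_le_mono1)
  \<comment> \<open>The factor \<open>?q ^ R\<close> completes the bound to the number of all words
    times the falling product. The word count is the number of profiles times \<open>\<rho>\<close>,
    and \<open>\<rho>\<close> then cancels.\<close>
  finally have "card ?G * \<rho> * ?q ^ R \<le> ((\<Prod>s<k. m s) * m k ^ R * (\<Prod>r<R. ?q - r)) * card tables * ?q ^ R"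
    by (rule mult_le_mono1)
  also have "\<dots> = card (words ?N) * (\<Prod>r<R. ?q - r) * card tables"
    unfolding N card_words_rounds[OF k] by (simp add: power_mult_distrib mult_ac)
  also have "card (words ?N) = card (profiles n m) * \<rho>"
    by (simp add: card_words prod_lessThan_add card_profiles \<rho>_def)
  finally have "(card ?G * ?q ^ R) * \<rho> \<le> (card tables * card (profiles n m) * (\<Prod>r<R. ?q - r)) * \<rho>"
    by (simp add: mult_ac)
  then have "card ?G * ?q ^ R \<le> card tables * card (profiles n m) * (\<Prod>r<R. ?q - r)"
    using \<open>\<rho> > 0\<close> by simp
  then have "real (card ?G * ?q ^ R) \<le> real (card tables * card (profiles n m) * (\<Prod>r<R. ?q - r))"
    by (rule of_nat_mono)
  then have "real (card ?G) * real ?q ^ R \<le> real (card tables * card (profiles n m)) * (\<Prod>r<R. real (?q - r))"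
    by simp
  moreover have "real (card tables * card (profiles n m)) > 0"
    using tables_nonempty profiles_nonempty by (simp add: card_gt_0_iff)
  ultimately have "real (card ?G) / real (card tables * card (profiles n m)) \<le> (\<Prod>r<R. real (?q - r)) / real ?q ^ R"
    using q by (simp add: divide_simps mult_ac)
  also have "\<dots> = (\<Prod>r<R. real (?q - r) / real ?q)"
    by (simp add: prod_dividef)
  also have "\<dots> \<le> exp (- (real R * (real R - 1)) / (2 * real ?q))"
    by (rule prod_falling_le_exp[OF q])
  finally show ?thesis by simp
qed

end

section \<open>From counts back to the probability\<close>

theorem lemma1:
  fixes n :: nat and m :: "nat \<Rightarrow> nat" and D :: "real measure" and t :: nat
  assumes "n \<ge> 2"
    and "\<And>i. i < n \<Longrightarrow> m i \<ge> 2"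
    and "prob_space D" and "sets D = sets borel"
    and "\<And>x. emeasure D {x} = 0"
    and "t \<ge> 1"
  shows "{\<omega> \<in> space (game_space n m D).
            enat t < hit_time n m (fst \<omega>) (snd \<omega>) \<and> hit_time n m (fst \<omega>) (snd \<omega>) < \<infinity>}
           \<in> sets (game_space n m D)
       \<and> measure (game_space n m D)
           {\<omega> \<in> space (game_space n m D).
              enat t < hit_time n m (fst \<omega>) (snd \<omega>) \<and> hit_time n m (fst \<omega>) (snd \<omega>) < \<infinity>}
         \<le> exp (- (real_of_int \<lfloor>real t / real n - 1\<rfloor>)\<^sup>2 / (2 * q_nm n m))"
proof -
  interpret atomless_game n m D
    by (intro atomless_game.intro game_params.intro atomless_game_axioms.intro assms)
  let ?E = "{\<omega> \<in> space (game_space n m D).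
    enat t < hit_time n m (fst \<omega>) (snd \<omega>) \<and> hit_time n m (fst \<omega>) (snd \<omega>) < \<infinity>}"
  define \<Phi> where "\<Phi> T a \<longleftrightarrow> enat t < hit_time n m (pay T) a \<and> hit_time n m (pay T) a < \<infinity>" for T a
  have "fst \<omega> \<in> extensional ({0..<n} \<times> profiles n m)" if "\<omega> \<in> space (game_space n m D)" for \<omega>
    using that by (auto simp: game_space_def space_pair_measure space_PiM PiE_iff)
  then have E: "?E = {\<omega> \<in> space (game_space n m D). \<Phi> (table (fst \<omega>)) (snd \<omega>)}"
    using hit_time_pay_table by (auto simp: \<Phi>_def)
  have "Max (m ` {0..<n}) \<in> m ` {0..<n}"
    using n_pos by (intro Max_in) auto
  then obtain k where k: "k < n" "m k = Max (m ` {0..<n})"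
    by auto
  have "real (card (ctx k)) * real (m k) = real (\<Prod>i<n. m i)"
    using card_ctx[OF k(1)] by (metis card_profiles of_nat_mult)
  then have q: "q_nm n m = card (ctx k)"
    using m_pos[OF k(1)] unfolding q_nm_def k(2)[symmetric] by (metis nonzero_mult_div_cancel_right of_nat_0_less_iff less_numeral_extra(3))
  have "\<lfloor>real t / real n\<rfloor> = int (t div n)"
    by (rule floor_divide_of_nat_eq)
  then have floor: "\<lfloor>real t / real n - 1\<rfloor> = int (t div n) - 1"
    by linarith
  have "card {(T, a). T \<in> tables \<and> a \<in> profiles n m \<and> \<Phi> T a} / (card tables * card (profiles n m))
    \<le> exp (- (real_of_int \<lfloor>real t / real n - 1\<rfloor>)\<^sup>2 / (2 * q_nm n m))"
  proof (cases "t < n")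
    case True
    then show ?thesis
      using hitting_fraction_small_time[OF \<open>t \<ge> 1\<close> k(1)] unfolding floor q \<Phi>_def by simp
  next
    case False
    define R where "R = t div n"
    have R: "1 \<le> R"
      using False n_pos by (simp add: R_def div_greater_zero_iff Suc_le_eq)
    \<comment> \<open>Since \<open>k < n\<close>, the \<open>R\<close>-th move of player
      \<open>k\<close> falls within the first \<open>R\<close> complete rounds.\<close>
    have "k + n * (R - 1) \<le> n * R"
      using k(1) R by (cases R) auto
    also have "\<dots> \<le> t"
      by (simp add: R_def)
    finally have "card {(T, a). T \<in> tables \<and> a \<in> profiles n m \<and> \<Phi> T a} / (card tables * card (profiles n m))
        \<le> exp (- (real R * (real R - 1)) / (2 * card (ctx k)))"
      unfolding \<Phi>_def by (rule hitting_fraction_rounds[OF k(1) R])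
    also have "\<dots> \<le> exp (- (real_of_int \<lfloor>real t / real n - 1\<rfloor>)\<^sup>2 / (2 * q_nm n m))"
    proof -
      \<comment> \<open>The floor in the claim equals \<open>R - 1\<close>, so the birthday exponent
        dominates the claimed one.\<close>
      have "(real R - 1)\<^sup>2 \<le> real R * (real R - 1)"
        using R by (simp add: power2_eq_square mult_right_mono)
      then have "(real R - 1)\<^sup>2 / (2 * card (ctx k)) \<le> real R * (real R - 1) / (2 * card (ctx k))"
        by (rule divide_right_mono) simp
      then show ?thesis
        unfolding floor q R_def by simp
    qed
    finally show ?thesis .
  qed
  then show ?thesis
    unfolding E using game_space_event[of \<Phi>] by simp
qed

end
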